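(* Consider the initial-boundary value problem (P) described in the context. Assume that $\lambda_i$, $f_i$, $\varphi_i$ and $h_i$ ($1\le i\le n$) are continuous functions of their arguments and that the $\lambda_i$ are Lipschitz in $x\in[0,1]$ (uniformly for $t$ in compact subsets of $[0,\infty)$). Suppose that $\nabla_y f(x,t,y)$ is bounded on $K\times\mathbb{R}^n$ for every compact $K\subset\overline{\Pi}$, and that $\nabla_z h(t,z)$ is bounded on $K\times\mathbb{R}^n$ for every compact $K\subset[0,\infty)$. Suppose that the zero-order compatibility conditions (stated in the context) are fulfilled. If $f(x,t,0)=0$ for all $(x,t)\in\overline{\Pi}$ and $h(t,0)=0$ for all $t\in[0,\infty)$, then the continuous solution to problem (P) depends continuously on $\varphi$; that is, for every $T>0$ the map $\varphi\mapsto u|_{[0,1]\times[0,T]}$, sending a continuous $\varphi$ satisfying the zero-order compatibility conditions to the continuous solution $u$ of (P), is continuous from the sup norm on $[0,1]$ to the sup norm on $[0,1]\times[0,T]$.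
   Context: Let $\Pi=\{(x,t)\mid 0<x<1,\ t>0\}$, and let $n\ge 1$ and $1\le k\le n$ be integers. The data are: real functions $\lambda_1,\dots,\lambda_n$ on $\overline{\Pi}$ with $\lambda_1,\dots,\lambda_k<0$ and $\lambda_{k+1},\dots,\lambda_n>0$ on $\overline{\Pi}$, and $\Lambda=\mathrm{diag}(\lambda_1,\dots,\lambda_n)$; a function $f=(f_1,\dots,f_n):\overline{\Pi}\times\mathbb{R}^n\to\mathbb{R}^n$; a function $\varphi=(\varphi_1,\dots,\varphi_n):[0,1]\to\mathbb{R}^n$; and a function $h=(h_1,\dots,h_n):[0,\infty)\times\mathbb{R}^n\to\mathbb{R}^n$. Problem (P): find $u=(u_1,\dots,u_n)$ with $$(\partial_t+\Lambda(x,t)\partial_x)u=f(x,t,u),\quad (x,t)\in\Pi,$$ $$u(x,0)=\varphi(x),\quad x\in(0,1),$$ $$u_i(0,t)=h_i(t,v(t)),\quad k+1\le i\le n,\ t\in(0,\infty),$$ $$u_i(1,t)=h_i(t,v(t)),\quad 1\le i\le k,\ t\in(0,\infty),$$ where $v(t)=(u_1(0,t),\dots,u_k(0,t),u_{k+1}(1,t),\dots,u_n(1,t))$. $\nabla_y f(x,t,y)$ and $\nabla_z h(t,z)$ denote the derivatives (assumed to exist) of $f$ and $h$ in their $\mathbb{R}^n$-argument. The dot $\cdot$ is the scalar product in $\mathbb{R}^n$. Characteristics: for $(x,t)\in\overline{\Pi}$, $\omega_i(\tau;x,t)$ denotes the $i$-th characteristic through $(x,t)$, i.e. the solution $\xi=\omega_i(\tau;x,t)$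 of $d\xi/d\tau=\lambda_i(\xi,\tau)$ with $\omega_i(t;x,t)=x$, and $t_i(x,t)$ is the smallest value of $\tau\ge0$ at which $\xi=\omega_i(\tau;x,t)$ reaches $\partial\Pi$. A continuous solution to (P) is a continuous function $u:\overline{\Pi}\to\mathbb{R}^n$ satisfying, for all $(x,t)\in\overline{\Pi}$ and $1\le i\le n$, $$u_i(x,t)=(R_iu)(x,t)+\int_{t_i(x,t)}^t\Bigl[u\cdot\int_0^1\nabla_uf_i(\omega_i(\tau;x,t),\tau,\sigma u)\,d\sigma+f_i(\omega_i(\tau;x,t),\tau,0)\Bigr]d\tau,$$ where inside the integral $u$ stands for $u(\omega_i(\tau;x,t),\tau)$ (so the bracket equals $f_i(\omega_i(\tau;x,t),\tau,u(\omega_i(\tau;x,t),\tau))$), and where $(R_iu)(x,t)=\varphi_i(\omega_i(0;x,t))$ if $t_i(x,t)=0$, while otherwise $$(R_iu)(x,t)=v(t_i(x,t))\cdot\int_0^1\nabla_vh_i(t_i(x,t),\sigma v(t_i(x,t)))\,d\sigma+h_i(t_i(x,t),0)$$ (which equals $h_i(t_i(x,t),v(t_i(x,t)))$). Under the assumptions of the claim preceding the conclusion, such a continuous solution exists and is unique. Zero-order compatibility conditions: with $v(0)=(\varphi_1(0),\dots,\varphi_k(0),\varphi_{k+1}(1),\dots,\varphi_n(1))$, one has $\varphi_i(0)=h_i(0,v(0))$ for $k+1\le i\le n$, and $\varphi_i(1)=h_i(0,v(0))$ for $1\le i\le k$. *)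

theory Defs
  imports "HOL-Analysis.Analysis"
begin

definition Pi_dom :: "(real \<times> real) set" where
  "Pi_dom = {(x, t). 0 < x \<and> x < 1 \<and> 0 < t}"

(* The components of real ^ 'n are numbered 1, ..., CARD('n) along the linear order of 'n;
   index_rank i is the number of the component i. *)
definition index_rank :: "'n::{finite,linorder} \<Rightarrow> nat" where
  "index_rank i = card {..i}"

(* \<xi> solves d\<xi>/d\<tau> = l(\<xi>, \<tau>), \<xi>(t) = x, on the whole segment between s and t (s may lie on either
   side of t), and its graph stays in the closure of Pi_dom, the domain of l.  At the end points
   of the segment the derivative is one-sided; for s = t the condition only says \<xi>(t) = x. *)
definition characteristic ::
    "(real \<Rightarrow> real \<Rightarrow> real) \<Rightarrow> real \<Rightarrow>
     real \<Rightarrow> real \<Rightarrow> (real \<Rightarrow> real) \<Rightarrow>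
     bool" where
  "characteristic l x t s \<xi> \<longleftrightarrow> \<xi> t = x \<and>
     (\<forall>\<tau>\<in>closed_segment s t. (\<xi> \<tau>, \<tau>) \<in> closure Pi_dom \<and>
        (\<xi> has_real_derivative l (\<xi> \<tau>) \<tau>) (at \<tau> within closed_segment s t))"

(* omega l \<tau> x t is \<omega>(\<tau>; x, t).  The value is meaningful when a characteristic through (x, t)
   exists up to time \<tau>; it is then unique if l is Lipschitz in its first argument. *)
definition omega :: "(real \<Rightarrow> real \<Rightarrow> real) \<Rightarrow>
     real \<Rightarrow> real \<Rightarrow> real \<Rightarrow> real" where
  "omega l \<tau> x t = (THE y. \<exists>\<xi>. characteristic l x t \<tau> \<xi> \<and> y = \<xi> \<tau>)"

definition exit_time :: "(real \<Rightarrow> real \<Rightarrow> real) \<Rightarrow>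
     real \<Rightarrow> real \<Rightarrow> real" where
  "exit_time l x t =
     (LEAST \<tau>. 0 \<le> \<tau> \<and> (\<exists>\<xi>. characteristic l x t \<tau> \<xi>) \<and> (omega l \<tau> x t, \<tau>) \<in> frontier Pi_dom)"

(* Boundary traces at which the characteristics leave the strip: at x = 0 for the components
   1, ..., k (negative speed), at x = 1 for the others. *)
definition outgoing ::
    "nat \<Rightarrow> (real \<Rightarrow> real ^ 'n::{finite,linorder}) \<Rightarrow>
     real ^ 'n::{finite,linorder}" where
  "outgoing k w = (\<chi> i. if index_rank i \<le> k then w 0 $ i else w 1 $ i)"

(* v(t) = (u_1(0,t), ..., u_k(0,t), u_(k+1)(1,t), ..., u_n(1,t)) *)
definition bvec ::
    "nat \<Rightarrow> (real \<Rightarrow> real \<Rightarrow> real ^ 'n::{finite,linorder}) \<Rightarrow>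
     real \<Rightarrow> real ^ 'n::{finite,linorder}" where
  "bvec k u t = outgoing k (\<lambda>x. u x t)"

definition compatible ::
    "nat \<Rightarrow> (real \<Rightarrow> real ^ 'n::{finite,linorder} \<Rightarrow> real ^ 'n::{finite,linorder}) \<Rightarrow>
     (real \<Rightarrow> real ^ 'n::{finite,linorder}) \<Rightarrow> bool" where
  "compatible k h \<phi> \<longleftrightarrow>
     (\<forall>i. k < index_rank i \<longrightarrow> \<phi> 0 $ i = h 0 (outgoing k \<phi>) $ i) \<and>
     (\<forall>i. index_rank i \<le> k \<longrightarrow> \<phi> 1 $ i = h 0 (outgoing k \<phi>) $ i)"

definition admissible_data ::
    "nat \<Rightarrow> (real \<Rightarrow> real ^ 'n::{finite,linorder} \<Rightarrow> real ^ 'n::{finite,linorder}) \<Rightarrow>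
     (real \<Rightarrow> real ^ 'n::{finite,linorder}) set" where
  "admissible_data k h = {\<phi>. continuous_on {0..1} \<phi> \<and> compatible k h \<phi>}"

(* The gradient of the i-th component is the i-th row of the Jacobian matrix. *)
definition R_op ::
    "nat \<Rightarrow> ('n::{finite,linorder} \<Rightarrow> real \<Rightarrow> real \<Rightarrow> real) \<Rightarrow>
     (real \<Rightarrow> real ^ 'n::{finite,linorder}) \<Rightarrow>
     (real \<Rightarrow> real ^ 'n::{finite,linorder} \<Rightarrow> real ^ 'n::{finite,linorder}) \<Rightarrow>
     (real \<Rightarrow> real \<Rightarrow> real ^ 'n::{finite,linorder}) \<Rightarrow>
     'n::{finite,linorder} \<Rightarrow> real \<Rightarrow> real \<Rightarrow> real" where
  "R_op k lam \<phi> h u i x t =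
     (let s = exit_time (lam i) x t in
      if s = 0 then \<phi> (omega (lam i) 0 x t) $ i
      else bvec k u s \<bullet> integral {0..1} (\<lambda>\<sigma>. jacobian (h s) (at (\<sigma> *\<^sub>R bvec k u s)) $ i)
           + h s 0 $ i)"

definition continuous_solution ::
    "nat \<Rightarrow> ('n::{finite,linorder} \<Rightarrow> real \<Rightarrow> real \<Rightarrow> real) \<Rightarrow>
     (real \<Rightarrow> real \<Rightarrow> real ^ 'n::{finite,linorder} \<Rightarrow> real ^ 'n::{finite,linorder}) \<Rightarrow>
     (real \<Rightarrow> real ^ 'n::{finite,linorder}) \<Rightarrow> (real \<Rightarrow> real ^ 'n::{finite,linorder} \<Rightarrow> real ^ 'n::{finite,linorder}) \<Rightarrow>
     (real \<Rightarrow> real \<Rightarrow> real ^ 'n::{finite,linorder}) \<Rightarrow> bool" where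
  "continuous_solution k lam f \<phi> h u \<longleftrightarrow>
     continuous_on (closure Pi_dom) (\<lambda>(x, t). u x t) \<and>
     (\<forall>(x, t)\<in>closure Pi_dom. \<forall>i.
        u x t $ i = R_op k lam \<phi> h u i x t +
          integral {exit_time (lam i) x t..t} (\<lambda>\<tau>.
            let \<xi> = omega (lam i) \<tau> x t; y = u \<xi> \<tau> in
              y \<bullet> integral {0..1} (\<lambda>\<sigma>. jacobian (f \<xi> \<tau>) (at (\<sigma> *\<^sub>R y)) $ i)
              + f \<xi> \<tau> 0 $ i))"

definition sup_norm_on :: "'a set \<Rightarrow> ('a \<Rightarrow> 'b::real_normed_vector) \<Rightarrow>
     real" where
  "sup_norm_on A g = (SUP a\<in>A. norm (g a))"

end

theory Submission
  imports Defs
begin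

text \<open>
  For two solutions, the difference of the representation formulas bounds each component of
  \<open>w = u - v\<close> at \<open>(x, t)\<close> by the initial difference or a multiple of the outgoing traces of \<open>w\<close> at
  the exit time, plus the integral of a multiple of \<open>norm w\<close> along the characteristic. In a supremum
  norm weighted by \<open>exp (c * (distance to the entry side - 1) - \<gamma> * t)\<close>, with \<open>c\<close> large and then \<open>\<gamma>\<close>
  large, the last two contributions are each at most a quarter of the norm of \<open>w\<close>, for all times up
  to \<open>T\<close> at once. Hence the solution depends Lipschitz continuously on the initial data.
\<close>

text \<open>A weight in time alone cannot control the boundary term: for points near the entry side
  the exit time is close to \<open>t\<close>, so nothing is gained in between, while the Lipschitz
  constant of the boundary map may exceed 1. The spatial factor supplies the gain, because boundary
  values are fed by traces at the exit side and received at the entry side. Its price is a factor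
  \<open>exp c\<close> when \<open>norm w\<close> is estimated at interior points; hence
  \<open>c\<close> is fixed from the boundary map and the dimension, and \<gamma> only afterwards
  from \<open>c\<close>, the maximal speed and the gradient bound of \<open>f\<close>. Two obstacles
  come from the solution formula itself. Characteristics and exit times are given by
  \<open>THE\<close> and \<open>LEAST\<close>, so backward existence, uniqueness and strict
  monotonicity must be known before they can be evaluated. The gradients are bounded but possibly
  discontinuous, so the averaged Jacobian is converted into a difference of values by the
  fundamental theorem for the gauge integral; after that only Lipschitz bounds of \<open>f\<close>
  and \<open>h\<close> enter.\<close>

text \<open>The scaling by \<open>exp (2 * M * (b - s))\<close> makes the Picard operator a contraction on all of
  \<open>{a..b}\<close>, whatever the Lipschitz constant.\<close>
lemma picard_backward:
  fixes F :: "'a::banach \<Rightarrow> real \<Rightarrow> 'a"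
  assumes cont: "continuous_on (UNIV \<times> {a..b}) (\<lambda>(y, s). F y s)"
    and lip: "\<And>s. s \<in> {a..b} \<Longrightarrow> L-lipschitz_on UNIV (\<lambda>y. F y s)"
    and "a \<le> b"
  shows "\<exists>\<xi>. \<xi> b = x \<and>
    (\<forall>\<tau>\<in>{a..b}. (\<xi> has_vector_derivative F (\<xi> \<tau>) \<tau>) (at \<tau> within {a..b}))"
proof -
  define M where "M = max L 1"
  have M: "M \<ge> 1" "L \<le> M" by (auto simp: M_def)
  have lipM: "norm (F y s - F z s) \<le> M * norm (y - z)" if "s \<in> {a..b}" for y z s
    using lipschitz_onD[OF lip[OF that], of y z] mult_right_mono[OF M(2), of "norm (y - z)"]
    by (auto simp: dist_norm)
  define E where "E s = exp (2 * M * (b - s))" for s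
  have contE: "continuous_on S E" for S unfolding E_def by (intro continuous_intros)
  \<comment> \<open>The unknown is \<open>g\<close> in \<xi> = x + E g. The Picard equation, \<xi>
    at \<open>s\<close> equals \<open>x\<close> minus the integral of \<open>H g\<close> over
    {s..b}, then reads \<open>g = P g\<close>.\<close>
  define H where "H g s = F (x + E s *\<^sub>R apply_bcontfun g s) s" for g :: "real \<Rightarrow>\<^sub>C 'a" and s
  have contH: "continuous_on {a..b} (H g)" for g
  proof -
    have "continuous_on {a..b} ((\<lambda>(y, s). F y s) \<circ> (\<lambda>s. (x + E s *\<^sub>R apply_bcontfun g s, s)))"
      by (intro continuous_on_compose continuous_intros contE)
        (auto intro!: continuous_on_subset[OF cont])
    then show ?thesis by (simp add: H_def[abs_def] o_def)
  qed
  have der: "((\<lambda>s. integral {s..b} (H g)) has_vector_derivative - H g s) (at s within {a..b})"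
    if "s \<in> {a..b}" for g s
    by (rule integral_has_vector_derivative'[OF contH that])
  define P where "P g s = - (inverse (E s) *\<^sub>R integral {s..b} (H g))" for g s
  have Epos: "E s > 0" for s by (simp add: E_def)
  have contP: "continuous_on {a..b} (P g)" for g
  proof -
    have "continuous_on {a..b} (\<lambda>s. integral {s..b} (H g))"
      by (rule continuous_on_vector_derivative[OF der])
    then show ?thesis unfolding P_def using Epos
      by (intro continuous_intros contE) (auto simp: less_imp_neq[symmetric])
  qed
  \<comment> \<open>The fixed point is sought in the complete space of bounded continuous functions
    on the whole line, so \<open>P g\<close> is continued by constants outside {a..b}.\<close>
  define G where "G g = (SOME g'. \<forall>s. apply_bcontfun g' s = P g (clamp a b s))" for g
  have G: "apply_bcontfun (G g) s = P g (clamp a b s)" for g s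
  proof -
    have "\<exists>g'. \<forall>s. apply_bcontfun g' s = P g (clamp a b s)"
      by (rule continuous_on_cbox_bcontfunE[of a b "P g"]) (use contP[of g] in \<open>auto simp: cbox_interval\<close>)
    then have "\<forall>s. apply_bcontfun (G g) s = P g (clamp a b s)"
      unfolding G_def by (rule someI_ex)
    then show ?thesis ..
  qed
  have contr: "dist (G g) (G g') \<le> 1/2 * dist g g'" for g g'
  proof (rule dist_bound)
    fix s0
    define s where "s = clamp a b s0"
    have s: "s \<in> {a..b}"
      using clamp_in_interval[of a b s0] \<open>a \<le> b\<close> by (auto simp: s_def cbox_interval)
    have intH: "H g integrable_on {s..b}" for g
      using s by (intro integrable_continuous_real continuous_on_subset[OF contH]) auto
    have primE: "((\<lambda>r. - (E r / (2 * M))) has_vector_derivative E r) (at r within {s..b})" for r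
      unfolding E_def using M
      by (auto intro!: derivative_eq_intros simp: has_real_derivative_iff_has_vector_derivative[symmetric])
    \<comment> \<open>\<open>M\<close> times this integral is at most \<open>E s / 2\<close>; the
      division by \<open>E s\<close> in \<open>P\<close> leaves the contraction factor 1/2.\<close>
    have intE: "(E has_integral (E s - 1) / (2 * M)) {s..b}"
      using fundamental_theorem_of_calculus[of s b "\<lambda>r. - (E r / (2 * M))" E, OF _ primE] s
      by (auto simp: E_def diff_divide_distrib)
    have "norm (integral {s..b} (H g) - integral {s..b} (H g')) = norm (integral {s..b} (\<lambda>r. H g r - H g' r))"
      by (simp add: integral_diff intH)
    also have "\<dots> \<le> integral {s..b} (\<lambda>r. M * dist g g' * E r)"
    proof (rule integral_norm_bound_integral)
      show "(\<lambda>r. H g r - H g' r) integrable_on {s..b}" by (intro integrable_diff intH)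
      show "(\<lambda>r. M * dist g g' * E r) integrable_on {s..b}"
        using intE by (intro integrable_on_mult_right) auto
      fix r assume r: "r \<in> {s..b}"
      have "norm (H g r - H g' r) \<le> M * (norm (E r *\<^sub>R (apply_bcontfun g r - apply_bcontfun g' r)))"
        using lipM[of r "x + E r *\<^sub>R apply_bcontfun g r" "x + E r *\<^sub>R apply_bcontfun g' r"] r s
        by (simp add: H_def scaleR_diff_right)
      also have "\<dots> = M * (E r * dist (apply_bcontfun g r) (apply_bcontfun g' r))"
        using Epos[of r] by (simp add: dist_norm)
      also have "\<dots> \<le> M * (E r * dist g g')"
        using M Epos[of r] by (intro mult_left_mono dist_bounded) auto
      finally show "norm (H g r - H g' r) \<le> M * dist g g' * E r" by (simp add: mult_ac)
    qed
    also have "\<dots> = dist g g' * (E s - 1) / 2"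
      using intE M by (simp add: integral_mult_right integral_unique)
    also have "\<dots> \<le> dist g g' * E s / 2"
      by (simp add: mult_left_mono)
    finally have *: "norm (integral {s..b} (H g) - integral {s..b} (H g')) \<le> dist g g' * E s / 2" .
    have "dist (apply_bcontfun (G g) s0) (apply_bcontfun (G g') s0)
        = norm (inverse (E s) *\<^sub>R (integral {s..b} (H g) - integral {s..b} (H g')))"
      unfolding G s_def[symmetric] P_def
      by (simp add: dist_norm scaleR_diff_right norm_minus_commute)
    also have "\<dots> = norm (integral {s..b} (H g) - integral {s..b} (H g')) / E s"
      using Epos[of s] by (simp add: divide_inverse mult.commute)
    also have "\<dots> \<le> 1/2 * dist g g'"
      using * Epos[of s] by (simp add: pos_divide_le_eq mult.commute)
    finally show "dist (apply_bcontfun (G g) s0) (apply_bcontfun (G g') s0) \<le> 1/2 * dist g g'" .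
  qed
  obtain g where g: "G g = g"
    using banach_fix_type[of "1/2" G] contr by auto
  define \<xi> where "\<xi> s = x + E s *\<^sub>R apply_bcontfun g s" for s
  have eq: "\<xi> s = x - integral {s..b} (H g)" if "s \<in> {a..b}" for s
  proof -
    have "clamp a b s = s" using that by (intro clamp_cancel_cbox) (auto simp: cbox_interval)
    then have "apply_bcontfun g s = P g s" using G[of g s] by (simp add: g)
    then show ?thesis using Epos[of s] by (simp add: \<xi>_def P_def)
  qed
  have "(\<xi> has_vector_derivative F (\<xi> s) s) (at s within {a..b})" if s: "s \<in> {a..b}" for s
  proof -
    have "((\<lambda>s. x - integral {s..b} (H g)) has_vector_derivative 0 - - H g s) (at s within {a..b})"
      by (intro has_vector_derivative_diff has_vector_derivative_const der s)
    then have "((\<lambda>s. x - integral {s..b} (H g)) has_vector_derivative F (\<xi> s) s) (at s within {a..b})"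
      by (simp add: H_def \<xi>_def)
    then show ?thesis
      using s by (rule has_vector_derivative_transform[rotated -1]) (simp_all add: eq)
  qed
  moreover have "\<xi> b = x" using eq[of b] \<open>a \<le> b\<close> by simp
  ultimately show ?thesis by blast
qed

section \<open>Characteristics in the strip: uniqueness, backward existence, exit times\<close>

lemma Pi_dom_eq_Times: "Pi_dom = {0<..<1} \<times> {0<..}"
  by (auto simp: Pi_dom_def)

lemma closure_Pi_dom: "closure Pi_dom = {0..1} \<times> {0..}"
  by (simp only: Pi_dom_eq_Times closure_Times) simp

lemma frontier_Pi_dom: "frontier Pi_dom = closure Pi_dom - Pi_dom"
proof -
  have "open Pi_dom" by (simp only: Pi_dom_eq_Times) (intro open_Times open_greaterThanLessThan open_greaterThan)
  then show ?thesis by (simp add: frontier_def interior_open)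
qed

lemma characteristic_subinterval:
  assumes "characteristic l x t s \<xi>" "s \<le> r" "r \<le> t"
  shows "characteristic l x t r \<xi>"
proof -
  have sub: "closed_segment r t \<subseteq> closed_segment s t"
    using assms(2,3) by (auto simp: closed_segment_eq_real_ivl)
  then show ?thesis
    using assms(1) DERIV_subset[OF _ sub] unfolding characteristic_def by blast
qed

lemma characteristicD:
  assumes "characteristic l x t s \<xi>" "s \<le> r" "r \<le> t"
  shows "\<xi> r \<in> {0..1}" "0 \<le> r"
    "(\<xi> has_real_derivative l (\<xi> r) r) (at r within {s..t})"
  using assms by (auto simp: characteristic_def closed_segment_eq_real_ivl closure_Pi_dom split: if_splits)

lemma mvt_within:
  fixes g :: "real \<Rightarrow> real"
  assumes "a < b" "\<And>r. a \<le> r \<Longrightarrow> r \<le> b \<Longrightarrow> (g has_real_derivative g' r) (at r within {a..b})"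
  obtains r where "a < r" "r < b" "g b - g a = g' r * (b - a)"
  using mvt_simple[of a b g "\<lambda>r h. g' r * h"] assms
  by (auto simp: has_field_derivative_def)

lemma characteristic_strict_mono:
  assumes "characteristic l x t s \<xi>" "s \<le> a" "a < b" "b \<le> t"
    and pos: "\<And>y r. (y, r) \<in> closure Pi_dom \<Longrightarrow> l y r > 0"
  shows "\<xi> a < \<xi> b"
proof -
  obtain r where r: "a < r" "r < b" "\<xi> b - \<xi> a = l (\<xi> r) r * (b - a)"
    using assms(1-4)
    by (elim mvt_within[of a b \<xi> "\<lambda>r. l (\<xi> r) r", rotated 2])
      (auto intro!: DERIV_subset[OF characteristicD(3)])
  moreover have "l (\<xi> r) r > 0"
    using characteristicD(1,2)[OF assms(1), of r] r assms(2-4) by (intro pos) (auto simp: closure_Pi_dom)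
  ultimately show ?thesis using \<open>a < b\<close> by (smt (verit) mult_pos_pos)
qed

text \<open>A Gronwall argument backward from the common value at \<open>t\<close>: by the Lipschitz
  bound the squared distance times \<open>exp (2 * L * q)\<close> is nondecreasing in
  \<open>q\<close>, and it vanishes at \<open>q = t\<close>, so it cannot be positive
  earlier.\<close>

lemma characteristic_unique:
  assumes \<xi>: "characteristic l x t s \<xi>" and \<eta>: "characteristic l x t s \<eta>" and r: "s \<le> r" "r \<le> t"
    and lip: "\<And>q. q \<in> {s..t} \<Longrightarrow> L-lipschitz_on {0..1} (\<lambda>y. l y q)"
  shows "\<xi> r = \<eta> r"
proof (cases "r = t")
  case True
  then show ?thesis using \<xi> \<eta> by (simp add: characteristic_def)
next
  case False
  define D where "D q = (\<xi> q - \<eta> q)\<^sup>2 * exp (2 * L * q)" for q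
  define D' where "D' q = 2 * exp (2 * L * q) *
    ((\<xi> q - \<eta> q) * (l (\<xi> q) q - l (\<eta> q) q) + L * (\<xi> q - \<eta> q)\<^sup>2)" for q
  have der: "(D has_real_derivative D' q) (at q within {r..t})" if "r \<le> q" "q \<le> t" for q
    unfolding D_def D'_def
    using that r
    by (auto intro!: derivative_eq_intros DERIV_subset[OF characteristicD(3)[OF \<xi>]]
        DERIV_subset[OF characteristicD(3)[OF \<eta>]] simp: algebra_simps power2_eq_square)
  obtain q where q: "r < q" "q < t" "D t - D r = D' q * (t - r)"
    using mvt_within[of r t D D'] der r False by auto
  have "\<bar>l (\<xi> q) q - l (\<eta> q) q\<bar> \<le> L * \<bar>\<xi> q - \<eta> q\<bar>"
    using lipschitz_onD[OF lip[of q], of "\<xi> q" "\<eta> q"] q r characteristicD(1)[OF \<xi>, of q]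
      characteristicD(1)[OF \<eta>, of q] by (auto simp: dist_real_def)
  then have "\<bar>\<xi> q - \<eta> q\<bar> * \<bar>l (\<xi> q) q - l (\<eta> q) q\<bar> \<le> \<bar>\<xi> q - \<eta> q\<bar> * (L * \<bar>\<xi> q - \<eta> q\<bar>)"
    by (intro mult_left_mono) auto
  also have "\<dots> = L * (\<xi> q - \<eta> q)\<^sup>2"
    by (metis abs_mult_self_eq mult.left_commute power2_eq_square)
  finally have "\<bar>(\<xi> q - \<eta> q) * (l (\<xi> q) q - l (\<eta> q) q)\<bar> \<le> L * (\<xi> q - \<eta> q)\<^sup>2"
    by (simp add: abs_mult)
  then have "D' q \<ge> 0" unfolding D'_def by (intro mult_nonneg_nonneg) auto
  moreover have "D t = 0" using \<xi> \<eta> by (simp add: D_def characteristic_def)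
  ultimately have "D r \<le> 0"
    using q r by (smt (verit) mult_nonneg_nonneg)
  then have "(\<xi> r - \<eta> r)\<^sup>2 \<le> 0" by (simp add: D_def mult_le_0_iff)
  then show ?thesis by simp
qed

text \<open>Picard's theorem asks for a field on the whole line, so the space argument of
  \<open>l\<close> is clamped to [0, 1]; clamping is nonexpansive and keeps \<open>L\<close>. The
  extended field is still positive, so its solution increases and, followed backward from
  \<open>x\<close>, can leave [0, 1] only through 0; until then it is a genuine characteristic. The
  nonexistence clause prepares the minimality of the exit time.\<close>

lemma exit_characteristic_pos:
  assumes cont: "continuous_on (closure Pi_dom) (\<lambda>(x, t). l x t)"
    and pos: "\<And>y r. (y, r) \<in> closure Pi_dom \<Longrightarrow> l y r > 0"
    and lip: "\<And>q. q \<in> {0..t} \<Longrightarrow> L-lipschitz_on {0..1} (\<lambda>y. l y q)"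
    and x: "x \<in> {0..1}" and t: "0 \<le> t"
  shows "\<exists>s\<in>{0..t}. \<exists>\<xi>. characteristic l x t s \<xi> \<and>
    (s = 0 \<or> \<xi> s = 0 \<and> (\<forall>r\<in>{0..<s}. \<forall>\<eta>. \<not> characteristic l x t r \<eta>))"
proof -
  define c where "c y = max 0 (min 1 y)" for y :: real
  have c: "c y \<in> {0..1}" for y by (auto simp: c_def)
  have c_id: "c y = y" if "y \<in> {0..1}" for y using that by (auto simp: c_def)
  have contc: "continuous_on S c" for S unfolding c_def by (intro continuous_intros)
  have "continuous_on (UNIV \<times> {0..t}) ((\<lambda>(x, t). l x t) \<circ> (\<lambda>(y, s). (c y, s)))"
    using c by (intro continuous_on_compose continuous_on_subset[OF cont])
      (auto simp: closure_Pi_dom case_prod_beta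
        intro!: continuous_intros continuous_on_compose2[OF contc[of UNIV]])
  then have contF: "continuous_on (UNIV \<times> {0..t}) (\<lambda>(y, s). l (c y) s)"
    by (simp add: o_def case_prod_beta)
  have lipF: "L-lipschitz_on UNIV (\<lambda>y. l (c y) s)" if s: "s \<in> {0..t}" for s
  proof (rule lipschitz_onI)
    show L: "0 \<le> L" using lipschitz_on_nonneg[OF lip[OF s]] .
    fix y z
    have "dist (l (c y) s) (l (c z) s) \<le> L * dist (c y) (c z)"
      by (rule lipschitz_onD[OF lip[OF s] c c])
    also have "\<dots> \<le> L * dist y z"
      by (intro mult_left_mono L) (auto simp: c_def dist_real_def)
    finally show "dist (l (c y) s) (l (c z) s) \<le> L * dist y z" .
  qed
  obtain \<xi> where \<xi>t: "\<xi> t = x" and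
    der: "\<And>r. r \<in> {0..t} \<Longrightarrow> (\<xi> has_real_derivative l (c (\<xi> r)) r) (at r within {0..t})"
    using picard_backward[OF contF lipF t, of x]
    by (auto simp: has_real_derivative_iff_has_vector_derivative)
  have mono: "\<xi> a < \<xi> b" if ab: "0 \<le> a" "a < b" "b \<le> t" for a b
  proof -
    obtain r where r: "a < r" "r < b" "\<xi> b - \<xi> a = l (c (\<xi> r)) r * (b - a)"
      using ab by (elim mvt_within[of a b \<xi> "\<lambda>r. l (c (\<xi> r)) r", rotated 2])
        (auto intro!: DERIV_subset[OF der])
    moreover have "l (c (\<xi> r)) r > 0"
      using c r ab by (intro pos) (auto simp: closure_Pi_dom)
    ultimately show ?thesis using ab by (smt (verit) mult_pos_pos)
  qed
  have char: "characteristic l x t s \<xi>" if s: "0 \<le> s" "s \<le> t" "\<xi> s \<ge> 0" for s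
  proof -
    have "\<xi> r \<in> {0..1}" if "r \<in> {s..t}" for r
      using mono[of s r] mono[of r t] that s x \<xi>t by (cases "r = s"; cases "r = t") auto
    then show ?thesis using s \<xi>t
      by (auto simp: characteristic_def closed_segment_eq_real_ivl closure_Pi_dom c_id
          intro!: DERIV_subset[OF der, THEN DERIV_cong])
  qed
  show ?thesis
  proof (cases "\<xi> 0 \<ge> 0")
    case True
    then show ?thesis using char[of 0] t by (intro bexI[of _ 0]) auto
  next
    case False
    have "continuous_on {0..t} \<xi>" by (rule DERIV_continuous_on[OF der])
    then obtain s where s: "0 \<le> s" "s \<le> t" "\<xi> s = 0"
      using IVT'[of \<xi> 0 0 t] False x t \<xi>t by auto
    then have \<xi>s: "characteristic l x t s \<xi>" using char by simp
    \<comment> \<open>A characteristic reaching further back would agree with \<xi> at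
      \<open>s\<close>, so it would be 0 there and negative before.\<close>
    have "\<not> characteristic l x t r \<eta>" if r: "r \<in> {0..<s}" for r \<eta>
    proof
      assume \<eta>: "characteristic l x t r \<eta>"
      have "\<eta> s = \<xi> s"
        using s r by (intro characteristic_unique[OF characteristic_subinterval[OF \<eta>] \<xi>s _ _ lip]) auto
      moreover have "\<eta> r < \<eta> s"
        using characteristic_strict_mono[OF \<eta> _ _ _ pos, of r s] r s by auto
      ultimately show False using characteristicD(1)[OF \<eta>, of r] r s by auto
    qed
    then show ?thesis using s \<xi>s by (intro bexI[of _ s]) auto
  qed
qed

text \<open>The reflection of the strip exchanges the two signs of the speed, which reduces the
  negative case to the positive one. Being an involution, it also brings a characteristic of the
  reflected field back to \<open>l\<close>.\<close>

lemma characteristic_reflect: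
  assumes "characteristic l x t s \<xi>"
  shows "characteristic (\<lambda>y r. - l (1 - y) r) (1 - x) t s (\<lambda>r. 1 - \<xi> r)"
  using assms unfolding characteristic_def closure_Pi_dom
  by (auto intro!: derivative_eq_intros)

lemma exit_characteristic_neg:
  assumes cont: "continuous_on (closure Pi_dom) (\<lambda>(x, t). l x t)"
    and neg: "\<And>y r. (y, r) \<in> closure Pi_dom \<Longrightarrow> l y r < 0"
    and lip: "\<And>q. q \<in> {0..t} \<Longrightarrow> L-lipschitz_on {0..1} (\<lambda>y. l y q)"
    and x: "x \<in> {0..1}" and t: "0 \<le> t"
  shows "\<exists>s\<in>{0..t}. \<exists>\<xi>. characteristic l x t s \<xi> \<and>
    (s = 0 \<or> \<xi> s = 1 \<and> (\<forall>r\<in>{0..<s}. \<forall>\<eta>. \<not> characteristic l x t r \<eta>))"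
proof -
  let ?l = "\<lambda>y r. - l (1 - y) r"
  have "continuous_on (closure Pi_dom) ((\<lambda>(x, t). l x t) \<circ> (\<lambda>(y, s). (1 - y, s)))"
    by (intro continuous_on_compose continuous_on_subset[OF cont])
      (auto simp: closure_Pi_dom case_prod_beta intro!: continuous_intros)
  then have "continuous_on (closure Pi_dom) (\<lambda>(x, t). ?l x t)"
    by (auto simp: o_def case_prod_beta intro!: continuous_intros)
  moreover have "?l y r > 0" if "(y, r) \<in> closure Pi_dom" for y r
    using neg[of "1 - y" r] that by (auto simp: closure_Pi_dom)
  moreover have "L-lipschitz_on {0..1} (\<lambda>y. ?l y q)" if q: "q \<in> {0..t}" for q
  proof (rule lipschitz_onI)
    show "0 \<le> L" using lipschitz_on_nonneg[OF lip[OF q]] .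
    fix y z :: real assume "y \<in> {0..1}" "z \<in> {0..1}"
    then show "dist (?l y q) (?l z q) \<le> L * dist y z"
      using lipschitz_onD[OF lip[OF q], of "1 - y" "1 - z"] by (auto simp: dist_real_def abs_minus_commute)
  qed
  moreover have "1 - x \<in> {0..1}" using x by auto
  ultimately obtain s \<xi> where s: "s \<in> {0..t}" "characteristic ?l (1 - x) t s \<xi>"
    "s = 0 \<or> \<xi> s = 0 \<and> (\<forall>r\<in>{0..<s}. \<forall>\<eta>. \<not> characteristic ?l (1 - x) t r \<eta>)"
    using exit_characteristic_pos[of ?l t L "1 - x"] t by blast
  have "characteristic l x t s (\<lambda>r. 1 - \<xi> r)"
    using characteristic_reflect[OF s(2)] by simp
  moreover have "\<not> characteristic l x t r \<eta>" if "s \<noteq> 0" "r \<in> {0..<s}" for r \<eta>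
    using s(3) that characteristic_reflect[of l x t r \<eta>] by blast
  ultimately show ?thesis
    using s(1,3) by (intro bexI[of _ s] exI[of _ "\<lambda>r. 1 - \<xi> r"]) auto
qed

text \<open>Evaluates \<open>LEAST\<close> and \<open>THE\<close>. Uniqueness makes every
  characteristic through \<open>(x, t)\<close> give the same value; at time \<open>s\<close> the
  graph lies on the frontier, since \<open>s = 0\<close> or the position is the entry end
  \<open>e\<close>; and before a positive \<open>s\<close> there is no characteristic that could
  compete.\<close>

lemma exit_time_omega:
  assumes cont: "continuous_on (closure Pi_dom) (\<lambda>(x, t). l x t)"
    and sign: "e = 0 \<and> (\<forall>(y, r)\<in>closure Pi_dom. l y r > 0) \<or>
      e = 1 \<and> (\<forall>(y, r)\<in>closure Pi_dom. l y r < 0)"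
    and lip: "\<And>q. q \<in> {0..t} \<Longrightarrow> L-lipschitz_on {0..1} (\<lambda>y. l y q)"
    and x: "x \<in> {0..1}" and t: "0 \<le> t"
  obtains s \<xi> where "exit_time l x t = s" "s \<in> {0..t}" "characteristic l x t s \<xi>"
    "s = 0 \<or> \<xi> s = e" "\<And>r. r \<in> {s..t} \<Longrightarrow> omega l r x t = \<xi> r"
proof -
  consider (pos) "e = 0" "\<And>y r. (y, r) \<in> closure Pi_dom \<Longrightarrow> l y r > 0"
    | (neg) "e = 1" "\<And>y r. (y, r) \<in> closure Pi_dom \<Longrightarrow> l y r < 0"
    using sign by auto
  then have "\<exists>s\<in>{0..t}. \<exists>\<xi>. characteristic l x t s \<xi> \<and>
    (s = 0 \<or> \<xi> s = e \<and> (\<forall>r\<in>{0..<s}. \<forall>\<eta>. \<not> characteristic l x t r \<eta>))"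
  proof cases
    case pos
    then show ?thesis using exit_characteristic_pos[OF cont pos(2) lip x t] by simp
  next
    case neg
    then show ?thesis using exit_characteristic_neg[OF cont neg(2) lip x t] by simp
  qed
  then obtain s \<xi> where s: "s \<in> {0..t}" and \<xi>: "characteristic l x t s \<xi>"
    and hit: "s = 0 \<or> \<xi> s = e \<and> (\<forall>r\<in>{0..<s}. \<forall>\<eta>. \<not> characteristic l x t r \<eta>)"
    by blast
  have om: "omega l r x t = \<xi> r" if r: "r \<in> {s..t}" for r
    unfolding omega_def
  proof (rule the_equality)
    have \<xi>r: "characteristic l x t r \<xi>" using characteristic_subinterval[OF \<xi>] r by auto
    then show "\<exists>\<eta>. characteristic l x t r \<eta> \<and> \<xi> r = \<eta> r" by blast
    fix y assume "\<exists>\<eta>. characteristic l x t r \<eta> \<and> y = \<eta> r"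
    then obtain \<eta> where "characteristic l x t r \<eta>" "y = \<eta> r" by blast
    then show "y = \<xi> r"
      using characteristic_unique[OF _ \<xi>r _ _ lip, of \<eta> r] r s by auto
  qed
  have e01: "e = 0 \<or> e = 1" using sign by auto
  have "exit_time l x t = s" unfolding exit_time_def
  proof (rule Least_equality)
    have "(\<xi> s, s) \<in> frontier Pi_dom"
      using characteristicD(1)[OF \<xi>, of s] s hit e01
      unfolding frontier_Pi_dom closure_Pi_dom by (auto simp: Pi_dom_def)
    then show "0 \<le> s \<and> (\<exists>\<xi>. characteristic l x t s \<xi>) \<and> (omega l s x t, s) \<in> frontier Pi_dom"
      using s \<xi> om[of s] by auto
    fix r assume "0 \<le> r \<and> (\<exists>\<xi>. characteristic l x t r \<xi>) \<and> (omega l r x t, r) \<in> frontier Pi_dom"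
    then show "s \<le> r" using hit by (meson atLeastLessThan_iff linorder_not_le)
  qed
  then show ?thesis using s \<xi> hit om by (intro that[of s \<xi>]) auto
qed

section \<open>Mean value formulas for differentiable maps with bounded Jacobian\<close>

text \<open>The norm of a matrix is the Euclidean norm of its row norms, so it bounds each row;
  Cauchy-Schwarz and the mean value inequality then pass the same \<open>B\<close> on to each
  component.\<close>

lemma jacobian_bound_component_lipschitz:
  fixes g :: "real ^ 'n \<Rightarrow> real ^ 'm"
  assumes diff: "\<And>y. g differentiable (at y)" and bnd: "\<And>y. norm (jacobian g (at y)) \<le> B"
  shows "\<bar>g y $ i - g z $ i\<bar> \<le> B * norm (y - z)"
proof -
  have "norm (g y $ i - g z $ i) \<le> B * norm (y - z)"
  proof (rule differentiable_bound[OF convex_UNIV, where f' = "\<lambda>y v. (jacobian g (at y) *v v) $ i"])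
    fix y
    have "(g has_derivative (\<lambda>v. jacobian g (at y) *v v)) (at y)"
      using diff[of y] by (simp add: jacobian_works)
    then show "((\<lambda>y. g y $ i) has_derivative (\<lambda>v. (jacobian g (at y) *v v) $ i)) (at y within UNIV)"
      by (rule bounded_linear.has_derivative[OF bounded_linear_vec_nth])
    show "onorm (\<lambda>v. (jacobian g (at y) *v v) $ i) \<le> B"
    proof (rule onorm_le)
      fix v
      have "norm ((jacobian g (at y) *v v) $ i) \<le> norm (jacobian g (at y) $ i) * norm v"
        by (simp only: matrix_vector_mul_component) (simp add: Cauchy_Schwarz_ineq2)
      also have "\<dots> \<le> B * norm v"
        using order_trans[OF Finite_Cartesian_Product.norm_nth_le bnd] by (intro mult_right_mono) auto
      finally show "norm ((jacobian g (at y) *v v) $ i) \<le> B * norm v" .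
    qed
  qed auto
  then show ?thesis by simp
qed

text \<open>The gradient need not be continuous; its components are limits of difference quotients.\<close>
lemma jacobian_row_integrable:
  fixes g :: "real ^ 'n \<Rightarrow> real ^ 'm"
  assumes diff: "\<And>y. g differentiable (at y)" and bnd: "\<And>y. norm (jacobian g (at y)) \<le> B"
  shows "(\<lambda>\<sigma>. jacobian g (at (\<sigma> *\<^sub>R z)) $ i) integrable_on {0..1}"
proof (subst integrable_componentwise_iff, rule ballI)
  fix b :: "real ^ 'n" assume "b \<in> Basis"
  then have b: "norm b = 1" by simp
  define Q where "Q m \<sigma> = (g (\<sigma> *\<^sub>R z + (1 / real (Suc m)) *\<^sub>R b) $ i - g (\<sigma> *\<^sub>R z) $ i) / (1 / real (Suc m))"
    for m \<sigma>
  have contg: "continuous_on UNIV g"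
    using diff by (simp add: continuous_on_eq_continuous_at differentiable_imp_continuous_within)
  show "(\<lambda>\<sigma>. jacobian g (at (\<sigma> *\<^sub>R z)) $ i \<bullet> b) integrable_on {0..1}"
  proof (rule dominated_convergence(1))
    show "Q m integrable_on {0..1}" for m
      unfolding Q_def
      by (intro integrable_continuous_real continuous_intros continuous_on_compose2[OF contg]) auto
    show "(\<lambda>\<sigma>. B) integrable_on {0..1::real}" by (rule integrable_const_ivl)
    show "norm (Q m \<sigma>) \<le> B" for m \<sigma>
    proof -
      define r where "r = 1 / real (Suc m)"
      have "r > 0" by (simp add: r_def)
      then show ?thesis
        using jacobian_bound_component_lipschitz[OF diff bnd, of "\<sigma> *\<^sub>R z + r *\<^sub>R b" i "\<sigma> *\<^sub>R z"] b
        unfolding Q_def r_def[symmetric] by (simp add: pos_divide_le_eq)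
    qed
    show "(\<lambda>m. Q m \<sigma>) \<longlonglongrightarrow> jacobian g (at (\<sigma> *\<^sub>R z)) $ i \<bullet> b" for \<sigma>
    proof -
      let ?J = "jacobian g (at (\<sigma> *\<^sub>R z))"
      have "(g has_derivative (\<lambda>v. ?J *v v)) (at (\<sigma> *\<^sub>R z + 0 *\<^sub>R b))"
        using diff[of "\<sigma> *\<^sub>R z"] by (simp add: jacobian_works)
      moreover have "((\<lambda>s. \<sigma> *\<^sub>R z + s *\<^sub>R b) has_derivative (\<lambda>s. s *\<^sub>R b)) (at 0)"
        by (auto intro!: derivative_eq_intros)
      ultimately have "((\<lambda>s. g (\<sigma> *\<^sub>R z + s *\<^sub>R b)) has_derivative (\<lambda>s. ?J *v (s *\<^sub>R b))) (at 0)"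
        by (rule has_derivative_compose[rotated])
      then have "((\<lambda>s. g (\<sigma> *\<^sub>R z + s *\<^sub>R b) $ i) has_derivative (\<lambda>s. (?J *v (s *\<^sub>R b)) $ i)) (at 0)"
        by (rule bounded_linear.has_derivative[OF bounded_linear_vec_nth])
      moreover have "(\<lambda>s. (?J *v (s *\<^sub>R b)) $ i) = (*) (?J $ i \<bullet> b)"
        by (simp add: matrix_vector_mul_component fun_eq_iff)
      ultimately have "((\<lambda>s. g (\<sigma> *\<^sub>R z + s *\<^sub>R b) $ i) has_real_derivative ?J $ i \<bullet> b) (at 0)"
        by (simp add: has_field_derivative_def)
      then have lim: "((\<lambda>s. (g (\<sigma> *\<^sub>R z + s *\<^sub>R b) $ i - g (\<sigma> *\<^sub>R z) $ i) / s) \<longlongrightarrow> ?J $ i \<bullet> b) (at 0)"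
        by (simp add: DERIV_def)
      have "filterlim (\<lambda>m. 1 / real (Suc m)) (at 0) sequentially"
        using LIMSEQ_inverse_real_of_nat by (auto simp: filterlim_at inverse_eq_divide)
      from filterlim_compose[OF lim this] show ?thesis by (simp add: Q_def)
    qed
  qed
qed

text \<open>Chain rule along the segment from 0 to \<open>z\<close>. The fundamental theorem for the
  gauge integral accepts a derivative that is not continuous; integrability of the whole row is what
  allows the inner product to move inside the integral.\<close>

lemma inner_integral_jacobian_row:
  fixes g :: "real ^ 'n \<Rightarrow> real ^ 'm"
  assumes diff: "\<And>y. g differentiable (at y)" and bnd: "\<And>y. norm (jacobian g (at y)) \<le> B"
  shows "z \<bullet> integral {0..1} (\<lambda>\<sigma>. jacobian g (at (\<sigma> *\<^sub>R z)) $ i) = g z $ i - g 0 $ i"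
proof -
  have der: "((\<lambda>\<sigma>. g (\<sigma> *\<^sub>R z) $ i) has_vector_derivative z \<bullet> jacobian g (at (\<sigma> *\<^sub>R z)) $ i) (at \<sigma> within {0..1})"
    for \<sigma>
  proof -
    let ?J = "jacobian g (at (\<sigma> *\<^sub>R z))"
    have "(g has_derivative (\<lambda>v. ?J *v v)) (at (\<sigma> *\<^sub>R z))"
      using diff[of "\<sigma> *\<^sub>R z"] by (simp add: jacobian_works)
    moreover have "((\<lambda>s. s *\<^sub>R z) has_derivative (\<lambda>s. s *\<^sub>R z)) (at \<sigma> within {0..1})"
      by (auto intro!: derivative_eq_intros)
    ultimately have "((\<lambda>s. g (s *\<^sub>R z)) has_derivative (\<lambda>s. ?J *v (s *\<^sub>R z))) (at \<sigma> within {0..1})"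
      by (rule has_derivative_compose[rotated])
    then have "((\<lambda>s. g (s *\<^sub>R z) $ i) has_derivative (\<lambda>s. (?J *v (s *\<^sub>R z)) $ i)) (at \<sigma> within {0..1})"
      by (rule bounded_linear.has_derivative[OF bounded_linear_vec_nth])
    then show ?thesis
      by (simp add: has_vector_derivative_def matrix_vector_mul_component inner_commute)
  qed
  have "z \<bullet> integral {0..1} (\<lambda>\<sigma>. jacobian g (at (\<sigma> *\<^sub>R z)) $ i)
      = integral {0..1} (\<lambda>\<sigma>. z \<bullet> jacobian g (at (\<sigma> *\<^sub>R z)) $ i)"
    using integral_linear[OF jacobian_row_integrable[OF diff bnd] bounded_linear_inner_right[of z], of z i]
    by (simp add: o_def)
  also have "\<dots> = g z $ i - g 0 $ i"
    using fundamental_theorem_of_calculus[of 0 1 "\<lambda>\<sigma>. g (\<sigma> *\<^sub>R z) $ i", OF _ der]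
    by (simp add: integral_unique)
  finally show ?thesis .
qed

text \<open>The end of the unit interval at which the \<open>i\<close>-th characteristics enter the strip.\<close>
definition entry :: "nat \<Rightarrow> 'n::{finite,linorder} \<Rightarrow> real" where
  "entry k i = (if index_rank i \<le> k then 1 else 0)"

text \<open>The factor in \<open>x\<close> is \<open>exp (- c)\<close> at the entry side and \<open>1\<close> at the exit side, so a large
  \<open>c\<close> damps the boundary reflection; a large \<open>\<gamma>\<close> then keeps the weight decreasing along
  characteristics and damps the integral term.\<close>
definition weight :: "real \<Rightarrow> real \<Rightarrow> nat \<Rightarrow> 'n::{finite,linorder} \<Rightarrow> real \<Rightarrow> real \<Rightarrow> real" where
  "weight \<gamma> c k i x t = exp (c * (\<bar>x - entry k i\<bar> - 1) - \<gamma> * t)"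

section \<open>Estimates in the weighted norm\<close>

lemma weight_entry: "weight \<gamma> c k i (entry k i) t = exp (- c) * exp (- (\<gamma> * t))"
  by (simp add: weight_def exp_diff exp_minus field_simps)

lemma weight_bounds:
  assumes "x \<in> {0..1}" "c \<ge> 0"
  shows "exp (- c) * exp (- (\<gamma> * t)) \<le> weight \<gamma> c k i x t" "weight \<gamma> c k i x t \<le> exp (- (\<gamma> * t))"
proof -
  have d: "\<bar>x - entry k i\<bar> \<in> {0..1}" using assms(1) by (auto simp: entry_def)
  show "exp (- c) * exp (- (\<gamma> * t)) \<le> weight \<gamma> c k i x t"
    using d assms(2) by (auto simp: weight_def exp_add[symmetric] right_diff_distrib)
  show "weight \<gamma> c k i x t \<le> exp (- (\<gamma> * t))"
    using d assms(2) by (auto simp: weight_def mult_nonneg_nonpos)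
qed

text \<open>Going back from \<open>t\<close> to \<open>s\<close> changes the distance to the entry
  side by at most \<open>\<Lambda> * (t - s)\<close>, hence the spatial exponent by at most
  \<open>\<gamma> * (t - s)\<close>, which the time factor makes up for.\<close>

lemma weight_antimono_along:
  assumes "\<bar>x - y\<bar> \<le> \<Lambda> * (t - s)" "c \<ge> 0" "c * \<Lambda> \<le> \<gamma>" "s \<le> t"
  shows "weight \<gamma> c k i x t \<le> weight \<gamma> c k i y s"
proof -
  have "c * (\<bar>x - entry k i\<bar> - \<bar>y - entry k i\<bar>) \<le> c * (\<Lambda> * (t - s))"
    using assms(1) by (intro mult_left_mono assms(2)) linarith
  also have "\<dots> \<le> \<gamma> * (t - s)"
    using mult_right_mono[OF assms(3), of "t - s"] assms(4) by (simp add: mult.assoc)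
  finally show ?thesis by (simp add: weight_def algebra_simps)
qed

lemma characteristic_speed:
  assumes \<xi>: "characteristic l x t s \<xi>" and "s \<le> t"
    and bnd: "\<And>y r. y \<in> {0..1} \<Longrightarrow> r \<in> {0..t} \<Longrightarrow> \<bar>l y r\<bar> \<le> \<Lambda>"
  shows "\<bar>x - \<xi> s\<bar> \<le> \<Lambda> * (t - s)"
proof (cases "s = t")
  case True
  then show ?thesis using \<xi> by (simp add: characteristic_def)
next
  case False
  then have "s < t" using \<open>s \<le> t\<close> by simp
  then obtain r where r: "s < r" "r < t" "\<xi> t - \<xi> s = l (\<xi> r) r * (t - s)"
    using mvt_within[of s t \<xi> "\<lambda>r. l (\<xi> r) r"] characteristicD(3)[OF \<xi>] by blast
  have "\<bar>l (\<xi> r) r\<bar> \<le> \<Lambda>"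
    using characteristicD(1,2)[OF \<xi>, of r] r by (intro bnd) auto
  then have "\<bar>l (\<xi> r) r\<bar> * \<bar>t - s\<bar> \<le> \<Lambda> * \<bar>t - s\<bar>"
    by (intro mult_right_mono) auto
  then show ?thesis using \<xi> r \<open>s < t\<close> by (simp add: characteristic_def abs_mult)
qed

lemma bvec_nth: "bvec k w t $ i = w (1 - entry k i) t $ i"
  by (simp add: bvec_def outgoing_def entry_def)

text \<open>Here \<open>q\<close> is any bound for the weighted components, later their supremum.
  The factors 4 in the last two size conditions leave \<open>q / 4\<close> for the boundary and
  \<open>q / 4\<close> for the integral; \<open>CARD('n)\<close> pays for estimating a Euclidean
  norm by the sum of the components.\<close>

lemma weighted_step:
  fixes w :: "real \<Rightarrow> real \<Rightarrow> real ^ 'n::{finite,linorder}"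
  assumes \<xi>: "characteristic l x t s \<xi>" and s: "0 \<le> s" "s \<le> t" and hit: "s = 0 \<or> \<xi> s = entry k i"
    and speed: "\<And>y r. y \<in> {0..1} \<Longrightarrow> r \<in> {0..t} \<Longrightarrow> \<bar>l y r\<bar> \<le> \<Lambda>"
    and w: "\<bar>w x t $ i\<bar> \<le> (if s = 0 then D else N * norm (bvec k w s))
      + integral {s..t} (\<lambda>r. M * norm (w (\<xi> r) r))"
    and int: "(\<lambda>r. M * norm (w (\<xi> r) r)) integrable_on {s..t}"
    and q: "\<And>y r j. y \<in> {0..1} \<Longrightarrow> r \<in> {0..t} \<Longrightarrow> weight \<gamma> c k j y r * \<bar>w y r $ j\<bar> \<le> q"
    and const: "0 \<le> D" "0 \<le> M" "0 \<le> N" "0 \<le> c" "c * \<Lambda> \<le> \<gamma>" "0 < \<gamma>"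
      "4 * N * CARD('n) \<le> exp c" "4 * M * CARD('n) * exp c \<le> \<gamma>"
  shows "weight \<gamma> c k i x t * \<bar>w x t $ i\<bar> \<le> D + q / 2"
proof -
  define n where "n = real CARD('n)"
  have x: "x \<in> {0..1}" using characteristicD(1)[OF \<xi>, of t] \<xi> s by (auto simp: characteristic_def)
  have q0: "0 \<le> q" using q[of x t i] x s by (auto simp: weight_def elim: order_trans[rotated])
  \<comment> \<open>At an arbitrary point the weight may be as small as at the entry side, which
    costs the factor \<open>exp c\<close>.\<close>
  have w_le: "norm (w y r) \<le> n * q * exp c * exp (\<gamma> * r)" if "y \<in> {0..1}" "r \<in> {0..t}" for y r
  proof -
    have "\<bar>w y r $ j\<bar> \<le> q * exp c * exp (\<gamma> * r)" for j
    proof -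
      have "exp (- c) * exp (- (\<gamma> * r)) * \<bar>w y r $ j\<bar> \<le> q"
        using mult_right_mono[OF weight_bounds(1)[OF that(1) const(4)], of "\<bar>w y r $ j\<bar>"] q[OF that, of j]
        by (meson abs_ge_zero order_trans)
      then show ?thesis by (simp add: exp_minus field_simps)
    qed
    then have "(\<Sum>j\<in>UNIV. \<bar>w y r $ j\<bar>) \<le> n * (q * exp c * exp (\<gamma> * r))"
      unfolding n_def by (intro sum_bounded_above) auto
    then show ?thesis using norm_le_l1_cart[of "w y r"] by (simp add: mult.assoc)
  qed
  \<comment> \<open>Outgoing traces escape this factor: at the end opposite to
    \<open>entry k j\<close> the weight is the pure time factor.\<close>
  have bvec_le: "norm (bvec k w s) \<le> n * (q * exp (\<gamma> * s))"
  proof -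
    have "\<bar>bvec k w s $ j\<bar> \<le> q * exp (\<gamma> * s)" for j
    proof -
      have "weight \<gamma> c k j (1 - entry k j) s = exp (- (\<gamma> * s))"
        by (simp add: weight_def entry_def)
      then have "exp (- (\<gamma> * s)) * \<bar>bvec k w s $ j\<bar> \<le> q"
        using q[of "1 - entry k j" s j] s by (simp add: bvec_nth entry_def)
      then show ?thesis by (simp add: exp_minus field_simps)
    qed
    then have "(\<Sum>j\<in>UNIV. \<bar>bvec k w s $ j\<bar>) \<le> n * (q * exp (\<gamma> * s))"
      unfolding n_def by (intro sum_bounded_above) auto
    then show ?thesis using norm_le_l1_cart[of "bvec k w s"] by simp
  qed
  define K where "K = M * n * q * exp c"
  have K0: "0 \<le> K" using const q0 by (simp add: K_def n_def)
  have intE: "((\<lambda>r. K * exp (\<gamma> * r)) has_integral K * exp (\<gamma> * t) / \<gamma> - K * exp (\<gamma> * s) / \<gamma>) {s..t}"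
    using s const by (intro fundamental_theorem_of_calculus)
      (auto intro!: derivative_eq_intros simp: has_real_derivative_iff_has_vector_derivative[symmetric])
  have "integral {s..t} (\<lambda>r. M * norm (w (\<xi> r) r)) \<le> K * exp (\<gamma> * t) / \<gamma> - K * exp (\<gamma> * s) / \<gamma>"
  proof (rule has_integral_le[OF integrable_integral[OF int] intE])
    fix r assume r: "r \<in> {s..t}"
    then have "M * norm (w (\<xi> r) r) \<le> M * (n * q * exp c * exp (\<gamma> * r))"
      using characteristicD(1)[OF \<xi>, of r] s const by (intro mult_left_mono w_le) auto
    then show "M * norm (w (\<xi> r) r) \<le> K * exp (\<gamma> * r)" by (simp add: K_def mult_ac)
  qed
  also have "\<dots> \<le> K * exp (\<gamma> * t) / \<gamma>" using K0 const by simp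
  \<comment> \<open>Integrating the exponential has gained \<open>1 / \<gamma>\<close>, which
    absorbs both \<open>M * n\<close> and the factor \<open>exp c\<close>.\<close>
  also have "\<dots> \<le> q / 4 * exp (\<gamma> * t)"
  proof -
    have "K \<le> q / 4 * \<gamma>"
      using mult_right_mono[OF const(8) q0] by (simp add: K_def n_def mult_ac)
    then have "K * exp (\<gamma> * t) \<le> q / 4 * \<gamma> * exp (\<gamma> * t)" by (intro mult_right_mono) auto
    then show ?thesis using const by (simp add: field_simps)
  qed
  finally have I: "integral {s..t} (\<lambda>r. M * norm (w (\<xi> r) r)) \<le> q / 4 * exp (\<gamma> * t)" .
  let ?p = "weight \<gamma> c k i x t"
  have p0: "0 \<le> ?p" and p1: "?p \<le> exp (- (\<gamma> * t))"
    using weight_bounds(2)[OF x const(4)] by (simp_all add: weight_def)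
  have "?p * integral {s..t} (\<lambda>r. M * norm (w (\<xi> r) r)) \<le> exp (- (\<gamma> * t)) * (q / 4 * exp (\<gamma> * t))"
    using p0 p1 I q0 by (intro order_trans[OF mult_left_mono[OF I p0] mult_right_mono]) auto
  also have "\<dots> = q / 4" by (simp add: exp_minus field_simps)
  finally have I': "?p * integral {s..t} (\<lambda>r. M * norm (w (\<xi> r) r)) \<le> q / 4" .
  have B: "?p * (if s = 0 then D else N * norm (bvec k w s)) \<le> D + q / 4"
  proof (cases "s = 0")
    case True
    have "exp (- (\<gamma> * t)) \<le> 1" using const s by simp
    then have "?p * D \<le> 1 * D" using p1 const by (intro mult_right_mono) linarith+
    then show ?thesis using True q0 by simp
  next
    case False
    \<comment> \<open>Followed back to the entry point the weight does not decrease, and there it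
      carries the factor \<open>exp (- c)\<close> that beats \<open>N * n\<close>.\<close>
    then have "?p \<le> exp (- c) * exp (- (\<gamma> * s))"
      using weight_antimono_along[OF characteristic_speed[OF \<xi> s(2) speed] const(4,5) s(2), of k i] hit
      by (simp add: weight_entry)
    then have "?p * (N * norm (bvec k w s)) \<le> exp (- c) * exp (- (\<gamma> * s)) * (N * (n * (q * exp (\<gamma> * s))))"
      using bvec_le const by (intro mult_mono mult_left_mono) auto
    also have "\<dots> = exp (- c) * (N * n * q)" by (simp add: exp_minus field_simps)
    also have "\<dots> \<le> q / 4"
      using mult_right_mono[OF const(7) q0] by (simp add: exp_minus n_def field_simps)
    finally show ?thesis using False const by simp
  qed
  have "?p * \<bar>w x t $ i\<bar> \<le> ?p * ((if s = 0 then D else N * norm (bvec k w s))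
      + integral {s..t} (\<lambda>r. M * norm (w (\<xi> r) r)))"
    by (rule mult_left_mono[OF w p0])
  also have "\<dots> \<le> (D + q / 4) + q / 4"
    unfolding distrib_left by (intro add_mono B I')
  finally show ?thesis by simp
qed

text \<open>With \<open>q = Sup S\<close> the supremum satisfies
  \<open>Sup S \<le> D + Sup S / 2\<close>; half of it is absorbed on the left, which is legitimate
  because \<open>S\<close> is bounded above.\<close>

lemma le_twice_if_contraction:
  fixes S :: "real set"
  assumes "bdd_above S" "\<And>q. (\<And>y. y \<in> S \<Longrightarrow> y \<le> q) \<Longrightarrow> (\<And>y. y \<in> S \<Longrightarrow> y \<le> D + q / 2)"
    and "z \<in> S"
  shows "z \<le> 2 * D"
proof -
  have "Sup S \<le> D + Sup S / 2"
    using assms cSup_upper[OF _ assms(1)] by (intro cSup_least) auto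
  then show ?thesis using cSup_upper[OF assms(3,1)] by simp
qed

section \<open>Representation along characteristics and the difference of two solutions\<close>

lemma characteristic_continuous_on:
  assumes "characteristic l x t s \<xi>"
  shows "continuous_on {s..t} \<xi>"
  by (rule DERIV_continuous_on[where D = "\<lambda>r. l (\<xi> r) r"]) (use characteristicD(3)[OF assms] in auto)

text \<open>By the gradient identities in the last two premises, each averaged gradient term is a
  value minus the value at 0, and the latter cancels against the summand added in the
  definition.\<close>

lemma continuous_solution_along_characteristic:
  assumes sol: "continuous_solution k lam f \<phi> h u"
    and xt: "(x, t) \<in> closure Pi_dom"
    and s: "exit_time (lam i) x t = s" "s \<in> {0..t}"
    and \<xi>: "characteristic (lam i) x t s \<xi>" "\<And>r. r \<in> {s..t} \<Longrightarrow> omega (lam i) r x t = \<xi> r"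
    and f: "\<And>x t y. (x, t) \<in> closure Pi_dom \<Longrightarrow>
      y \<bullet> integral {0..1} (\<lambda>\<sigma>. jacobian (f x t) (at (\<sigma> *\<^sub>R y)) $ i) = f x t y $ i - f x t 0 $ i"
    and h: "\<And>t z. 0 \<le> t \<Longrightarrow>
      z \<bullet> integral {0..1} (\<lambda>\<sigma>. jacobian (h t) (at (\<sigma> *\<^sub>R z)) $ i) = h t z $ i - h t 0 $ i"
  shows "u x t $ i = (if s = 0 then \<phi> (\<xi> 0) $ i else h s (bvec k u s) $ i)
    + integral {s..t} (\<lambda>r. f (\<xi> r) r (u (\<xi> r) r) $ i)"
proof -
  have "u x t $ i = R_op k lam \<phi> h u i x t +
      integral {exit_time (lam i) x t..t} (\<lambda>\<tau>.
        let \<xi> = omega (lam i) \<tau> x t; y = u \<xi> \<tau> in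
          y \<bullet> integral {0..1} (\<lambda>\<sigma>. jacobian (f \<xi> \<tau>) (at (\<sigma> *\<^sub>R y)) $ i) + f \<xi> \<tau> 0 $ i)"
    using sol xt unfolding continuous_solution_def by blast
  also have "R_op k lam \<phi> h u i x t = (if s = 0 then \<phi> (\<xi> 0) $ i else h s (bvec k u s) $ i)"
    using s \<xi>(2)[of s] h[of s "bvec k u s"] by (auto simp: R_op_def)
  also have "integral {exit_time (lam i) x t..t} (\<lambda>\<tau>.
        let \<xi> = omega (lam i) \<tau> x t; y = u \<xi> \<tau> in
          y \<bullet> integral {0..1} (\<lambda>\<sigma>. jacobian (f \<xi> \<tau>) (at (\<sigma> *\<^sub>R y)) $ i) + f \<xi> \<tau> 0 $ i)
      = integral {s..t} (\<lambda>r. f (\<xi> r) r (u (\<xi> r) r) $ i)"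
    unfolding s(1)
  proof (rule Henstock_Kurzweil_Integration.integral_cong)
    fix r assume r: "r \<in> {s..t}"
    then have "(\<xi> r, r) \<in> closure Pi_dom"
      using characteristicD(1,2)[OF \<xi>(1), of r] by (auto simp: closure_Pi_dom)
    then show "(let \<xi> = omega (lam i) r x t; y = u \<xi> r in
          y \<bullet> integral {0..1} (\<lambda>\<sigma>. jacobian (f \<xi> r) (at (\<sigma> *\<^sub>R y)) $ i) + f \<xi> r 0 $ i)
        = f (\<xi> r) r (u (\<xi> r) r) $ i"
      using f by (simp add: \<xi>(2)[OF r] Let_def)
  qed
  finally show ?thesis .
qed

text \<open>\<open>C\<close> is fixed before the initial data and the solutions, so it depends only
  on \<open>T\<close> and the coefficients; this uniformity turns the estimate into continuity of
  the solution map.\<close>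

lemma solution_difference_bound:
  fixes k :: nat
    and lam :: "'n::{finite,linorder} \<Rightarrow> real \<Rightarrow> real \<Rightarrow> real"
    and f :: "real \<Rightarrow> real \<Rightarrow> real ^ 'n::{finite,linorder} \<Rightarrow> real ^ 'n::{finite,linorder}"
    and h :: "real \<Rightarrow> real ^ 'n::{finite,linorder} \<Rightarrow> real ^ 'n::{finite,linorder}"
  assumes lam_neg: "\<And>i x t. index_rank i \<le> k \<Longrightarrow> (x, t) \<in> closure Pi_dom \<Longrightarrow> lam i x t < 0"
    and lam_pos: "\<And>i x t. k < index_rank i \<Longrightarrow> (x, t) \<in> closure Pi_dom \<Longrightarrow> lam i x t > 0"
    and lam_cont: "\<And>i. continuous_on (closure Pi_dom) (\<lambda>(x, t). lam i x t)"
    and lam_lipschitz: "\<And>i K. compact K \<Longrightarrow> K \<subseteq> {0..} \<Longrightarrow>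
          \<exists>L. \<forall>t\<in>K. L-lipschitz_on {0..1} (\<lambda>x. lam i x t)"
    and f_cont: "continuous_on (closure Pi_dom \<times> UNIV) (\<lambda>((x, t), y). f x t y)"
    and f_diff: "\<And>x t y. (x, t) \<in> closure Pi_dom \<Longrightarrow> f x t differentiable (at y)"
    and f_grad_bounded: "\<And>K. compact K \<Longrightarrow> K \<subseteq> closure Pi_dom \<Longrightarrow>
          bounded ((\<lambda>((x, t), y). jacobian (f x t) (at y)) ` (K \<times> UNIV))"
    and h_diff: "\<And>t z. 0 \<le> t \<Longrightarrow> h t differentiable (at z)"
    and h_grad_bounded: "\<And>K. compact K \<Longrightarrow> K \<subseteq> {0..} \<Longrightarrow>
          bounded ((\<lambda>(t, z). jacobian (h t) (at z)) ` (K \<times> UNIV))"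
  obtains C where "C \<ge> 0"
    "\<And>\<phi> \<psi> u v D x t. continuous_solution k lam f \<phi> h u \<Longrightarrow> continuous_solution k lam f \<psi> h v \<Longrightarrow>
      (\<And>y. y \<in> {0..1} \<Longrightarrow> norm (\<phi> y - \<psi> y) \<le> D) \<Longrightarrow> x \<in> {0..1} \<Longrightarrow> t \<in> {0..T} \<Longrightarrow>
      norm (u x t - v x t) \<le> C * D"
proof -
  define Q :: "(real \<times> real) set" where "Q = {0..1} \<times> {0..T}"
  have Q: "compact Q" "Q \<subseteq> closure Pi_dom"
    by (auto simp: Q_def closure_Pi_dom compact_Times)
  obtain \<Lambda> where \<Lambda>: "\<And>i x t. x \<in> {0..1} \<Longrightarrow> t \<in> {0..T} \<Longrightarrow> \<bar>lam i x t\<bar> \<le> \<Lambda>"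
  proof -
    have "\<exists>B. \<forall>x\<in>{0..1}. \<forall>t\<in>{0..T}. \<bar>lam i x t\<bar> \<le> B" for i
    proof -
      have "bounded ((\<lambda>(x, t). lam i x t) ` Q)"
        using Q by (intro compact_imp_bounded compact_continuous_image continuous_on_subset[OF lam_cont]) auto
      then show ?thesis by (auto simp: bounded_iff Q_def)
    qed
    then obtain B where B: "\<And>i x t. x \<in> {0..1} \<Longrightarrow> t \<in> {0..T} \<Longrightarrow> \<bar>lam i x t\<bar> \<le> B i"
      by metis
    then have "\<bar>lam i x t\<bar> \<le> Max (range B)" if "x \<in> {0..1}" "t \<in> {0..T}" for i x t
      using that by (intro order_trans[OF B Max_ge]) auto
    then show thesis using that by blast
  qed
  obtain M where M: "M > 0" "\<And>x t y. (x, t) \<in> Q \<Longrightarrow> norm (jacobian (f x t) (at y)) \<le> M"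
    using f_grad_bounded[OF Q] by (fastforce simp: bounded_pos)
  have "bounded ((\<lambda>(t, z). jacobian (h t) (at z)) ` ({0..T} \<times> UNIV))"
    by (rule h_grad_bounded) auto
  then obtain N where N: "N > 0" "\<And>t z. t \<in> {0..T} \<Longrightarrow> norm (jacobian (h t) (at z)) \<le> N"
    by (fastforce simp: bounded_pos)
  define n where "n = real CARD('n)"
  have n: "n > 0" by (simp add: n_def)
  \<comment> \<open>Chosen for \<open>4 * N * n \<le> exp c\<close>, which follows from
    \<open>exp c \<ge> 1 + c\<close>.\<close>
  define c where "c = 4 * N * n"
  \<comment> \<open>The first summand keeps the weight from growing along characteristics, the
    second beats the integral term. The absolute value is there because \<Lambda> may have any sign
    if \<open>T < 0\<close>.\<close>
  define \<gamma> where "\<gamma> = \<bar>c * \<Lambda>\<bar> + 4 * M * n * exp c"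
  have c: "c > 0" using N n by (simp add: c_def)
  have exp_c: "4 * N * n \<le> exp c"
    unfolding c_def[symmetric] using exp_ge_add_one_self[of c] by linarith
  have \<gamma>: "\<gamma> > 0" "c * \<Lambda> \<le> \<gamma>" "4 * M * n * exp c \<le> \<gamma>"
    using M n by (auto simp: \<gamma>_def intro!: add_nonneg_pos add_increasing2)
  \<comment> \<open>The weighted estimate gives \<open>2 * D\<close>; the exponential undoes the
    smallest weight and \<open>n\<close> sums the components.\<close>
  define C where "C = n * (2 * exp (c + \<gamma> * T))"
  have C: "C \<ge> 0" using n by (simp add: C_def)
  \<comment> \<open>A singleton is compact, so the gradient hypothesis bounds the Jacobian uniformly
    in \<open>y\<close> at each fixed \<open>(x, t)\<close>.\<close>
  have fid: "y \<bullet> integral {0..1} (\<lambda>\<sigma>. jacobian (f x t) (at (\<sigma> *\<^sub>R y)) $ i) = f x t y $ i - f x t 0 $ i"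
    if "(x, t) \<in> closure Pi_dom" for x t y i
  proof -
    have "bounded ((\<lambda>((x, t), y). jacobian (f x t) (at y)) ` ({(x, t)} \<times> UNIV))"
      using that by (intro f_grad_bounded) auto
    then obtain B where "\<And>y. norm (jacobian (f x t) (at y)) \<le> B"
      by (fastforce simp: bounded_iff)
    then show ?thesis by (rule inner_integral_jacobian_row[OF f_diff[OF that]])
  qed
  have hid: "z \<bullet> integral {0..1} (\<lambda>\<sigma>. jacobian (h t) (at (\<sigma> *\<^sub>R z)) $ i) = h t z $ i - h t 0 $ i"
    if "0 \<le> t" for t z i
  proof -
    have "bounded ((\<lambda>(t, z). jacobian (h t) (at z)) ` ({t} \<times> UNIV))"
      using that by (intro h_grad_bounded) auto
    then obtain B where "\<And>z. norm (jacobian (h t) (at z)) \<le> B"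
      by (fastforce simp: bounded_iff)
    then show ?thesis by (rule inner_integral_jacobian_row[OF h_diff[OF that]])
  qed
  have "norm (u x t - v x t) \<le> C * D"
    if u: "continuous_solution k lam f \<phi> h u" and v: "continuous_solution k lam f \<psi> h v"
      and D: "\<And>y. y \<in> {0..1} \<Longrightarrow> norm (\<phi> y - \<psi> y) \<le> D" and x: "x \<in> {0..1}" and t: "t \<in> {0..T}"
    for \<phi> \<psi> u v D x t
  proof -
    have D0: "0 \<le> D" using order_trans[OF norm_ge_zero D[of 0]] by simp
    have contu: "continuous_on (closure Pi_dom) (\<lambda>(x, t). u x t)"
      and contv: "continuous_on (closure Pi_dom) (\<lambda>(x, t). v x t)"
      using u v by (auto simp: continuous_solution_def)
    define w where "w x t = u x t - v x t" for x t
    have step: "weight \<gamma> c k i x t * \<bar>w x t $ i\<bar> \<le> D + q / 2"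
      if x: "x \<in> {0..1}" and t: "t \<in> {0..T}"
        and q: "\<And>y r j. y \<in> {0..1} \<Longrightarrow> r \<in> {0..T} \<Longrightarrow> weight \<gamma> c k j y r * \<bar>w y r $ j\<bar> \<le> q"
      for x t i q
    proof -
      have xt: "(x, t) \<in> closure Pi_dom" using x t by (simp add: closure_Pi_dom)
      obtain L where L: "\<And>r. r \<in> {0..T} \<Longrightarrow> L-lipschitz_on {0..1} (\<lambda>y. lam i y r)"
        using lam_lipschitz[OF compact_Icc, of 0 T i] by fastforce
      have sign: "entry k i = 0 \<and> (\<forall>(y, r)\<in>closure Pi_dom. lam i y r > 0) \<or>
          entry k i = 1 \<and> (\<forall>(y, r)\<in>closure Pi_dom. lam i y r < 0)"
        using lam_neg[of i] lam_pos[of i] by (cases "index_rank i \<le> k") (auto simp: entry_def)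
      obtain s \<xi> where s: "exit_time (lam i) x t = s" "s \<in> {0..t}"
        and \<xi>: "characteristic (lam i) x t s \<xi>" and hit: "s = 0 \<or> \<xi> s = entry k i"
        and om: "\<And>r. r \<in> {s..t} \<Longrightarrow> omega (lam i) r x t = \<xi> r"
        by (rule exit_time_omega[OF lam_cont sign, where t = t and L = L and x = x]) (use L x t in auto)
      have inQ: "(\<xi> r, r) \<in> Q" if "r \<in> {s..t}" for r
        using characteristicD(1)[OF \<xi>, of r] that s t by (auto simp: Q_def)
      then have inC: "(\<xi> r, r) \<in> closure Pi_dom" if "r \<in> {s..t}" for r
        using that Q(2) by blast
      have path: "continuous_on {s..t} (\<lambda>r. (\<xi> r, r))"
        by (intro continuous_intros characteristic_continuous_on[OF \<xi>])
      have alongpath: "continuous_on {s..t} (\<lambda>r. g (\<xi> r) r)"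
        if "continuous_on (closure Pi_dom) (\<lambda>(x, t). g x t)" for g :: "real \<Rightarrow> real \<Rightarrow> real ^ 'n::{finite,linorder}"
        using continuous_on_compose2[OF that path] inC by (simp add: image_subset_iff)
      have contf: "continuous_on {s..t} (\<lambda>r. f (\<xi> r) r (g (\<xi> r) r))"
        if "continuous_on (closure Pi_dom) (\<lambda>(x, t). g x t)" for g :: "real \<Rightarrow> real \<Rightarrow> real ^ 'n::{finite,linorder}"
        using continuous_on_compose2[OF f_cont continuous_on_Pair[OF path alongpath[OF that]]] inC
        by (simp add: image_subset_iff)
      have intf: "(\<lambda>r. f (\<xi> r) r (g (\<xi> r) r) $ i) integrable_on {s..t}"
        if "continuous_on (closure Pi_dom) (\<lambda>(x, t). g x t)" for g :: "real \<Rightarrow> real \<Rightarrow> real ^ 'n::{finite,linorder}"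
        by (intro integrable_continuous_real continuous_intros contf that)
      have contw: "continuous_on {s..t} (\<lambda>r. w (\<xi> r) r)"
        unfolding w_def by (intro continuous_intros alongpath contu contv)
      have intw: "(\<lambda>r. M * norm (w (\<xi> r) r)) integrable_on {s..t}"
        by (intro integrable_continuous_real continuous_intros contw)
      define A where "A g \<phi> = (if s = 0 then \<phi> (\<xi> 0) $ i else h s (bvec k g s) $ i)"
        for g :: "real \<Rightarrow> real \<Rightarrow> real ^ 'n::{finite,linorder}" and \<phi> :: "real \<Rightarrow> real ^ 'n::{finite,linorder}"
      have A: "\<bar>A u \<phi> - A v \<psi>\<bar> \<le> (if s = 0 then D else N * norm (bvec k w s))"
      proof (cases "s = 0")
        case True
        have "\<bar>(\<phi> (\<xi> 0) - \<psi> (\<xi> 0)) $ i\<bar> \<le> D"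
          using inQ[of 0] s True by (intro order_trans[OF component_le_norm_cart D]) (auto simp: Q_def)
        then show ?thesis using True by (simp add: A_def)
      next
        case False
        have "bvec k u s - bvec k v s = bvec k w s" by (simp add: vec_eq_iff bvec_nth w_def)
        then have "\<bar>h s (bvec k u s) $ i - h s (bvec k v s) $ i\<bar> \<le> N * norm (bvec k w s)"
          using jacobian_bound_component_lipschitz[of "h s" N "bvec k u s" i "bvec k v s"] h_diff N(2) s t
          by simp
        then show ?thesis using False by (simp add: A_def)
      qed
      have "norm (integral {s..t} (\<lambda>r. f (\<xi> r) r (u (\<xi> r) r) $ i - f (\<xi> r) r (v (\<xi> r) r) $ i))
          \<le> integral {s..t} (\<lambda>r. M * norm (w (\<xi> r) r))"
      proof (rule integral_norm_bound_integral)
        fix r assume r: "r \<in> {s..t}"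
        show "norm (f (\<xi> r) r (u (\<xi> r) r) $ i - f (\<xi> r) r (v (\<xi> r) r) $ i) \<le> M * norm (w (\<xi> r) r)"
          using jacobian_bound_component_lipschitz[OF f_diff[OF inC[OF r]] M(2)[OF inQ[OF r]]]
          by (simp add: w_def)
      qed (intro integrable_diff intf contu contv intw)+
      then have I: "\<bar>integral {s..t} (\<lambda>r. f (\<xi> r) r (u (\<xi> r) r) $ i) - integral {s..t} (\<lambda>r. f (\<xi> r) r (v (\<xi> r) r) $ i)\<bar>
          \<le> integral {s..t} (\<lambda>r. M * norm (w (\<xi> r) r))"
        by (simp add: integral_diff intf contu contv)
      have rep_u: "u x t $ i = A u \<phi> + integral {s..t} (\<lambda>r. f (\<xi> r) r (u (\<xi> r) r) $ i)"
        unfolding A_def by (rule continuous_solution_along_characteristic[OF u xt s \<xi> om fid hid])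
      have rep_v: "v x t $ i = A v \<psi> + integral {s..t} (\<lambda>r. f (\<xi> r) r (v (\<xi> r) r) $ i)"
        unfolding A_def by (rule continuous_solution_along_characteristic[OF v xt s \<xi> om fid hid])
      have "\<bar>w x t $ i\<bar> \<le> (if s = 0 then D else N * norm (bvec k w s))
          + integral {s..t} (\<lambda>r. M * norm (w (\<xi> r) r))"
        using A I rep_u rep_v by (simp add: w_def)
      from weighted_step[OF \<xi> _ _ hit _ this intw, of \<Lambda> \<gamma> c q]
      show ?thesis using s t \<Lambda> q D0 M N c exp_c \<gamma> by (auto simp: n_def)
    qed
    \<comment> \<open>\<open>Sup S\<close> is the weighted norm of \<open>w\<close> over all
      components and times up to \<open>T\<close>. It is finite because \<open>w\<close> is bounded
      on the compact \<open>Q\<close> and the weight is at most 1.\<close>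
    define S where "S = (\<lambda>((y, r), j). weight \<gamma> c k j y r * \<bar>w y r $ j\<bar>) ` (Q \<times> UNIV)"
    have "bdd_above S"
    proof -
      have "bounded ((\<lambda>(x, t). w x t) ` Q)"
        unfolding w_def case_prod_beta using Q contu contv
        by (intro compact_imp_bounded compact_continuous_image continuous_on_diff)
          (auto simp: case_prod_beta intro: continuous_on_subset)
      then obtain B where B: "\<And>y r. (y, r) \<in> Q \<Longrightarrow> norm (w y r) \<le> B"
        by (fastforce simp: bounded_iff)
      have "weight \<gamma> c k j y r * \<bar>w y r $ j\<bar> \<le> 1 * B" if "(y, r) \<in> Q" for y r j
      proof (rule mult_mono)
        have "exp (- (\<gamma> * r)) \<le> 1" using that \<gamma> by (simp add: Q_def)
        moreover have "weight \<gamma> c k j y r \<le> exp (- (\<gamma> * r))"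
          using weight_bounds(2)[where x = y and c = c and k = k and \<gamma> = \<gamma> and t = r and i = j] that c by (simp add: Q_def)
        ultimately show "weight \<gamma> c k j y r \<le> 1" by (rule order_trans[rotated])
        show "\<bar>w y r $ j\<bar> \<le> B"
          by (rule order_trans[OF component_le_norm_cart B[OF that]])
      qed auto
      then show ?thesis by (auto simp: S_def intro!: bdd_aboveI[of _ B])
    qed
    moreover have "a \<le> D + q / 2" if q: "\<And>b. b \<in> S \<Longrightarrow> b \<le> q" and a: "a \<in> S" for q a
    proof -
      have "weight \<gamma> c k j y r * \<bar>w y r $ j\<bar> \<le> q" if "y \<in> {0..1}" "r \<in> {0..T}" for y r j
        using that by (intro q) (force simp: S_def Q_def)
      with step show ?thesis using a by (auto simp: S_def Q_def)
    qed
    ultimately have fin: "a \<le> 2 * D" if "a \<in> S" for a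
      using le_twice_if_contraction[of S D a] that by blast
    have "\<bar>w x t $ i\<bar> \<le> 2 * exp (c + \<gamma> * T) * D" for i
    proof -
      have "exp (- (c + \<gamma> * T)) * \<bar>w x t $ i\<bar> \<le> weight \<gamma> c k i x t * \<bar>w x t $ i\<bar>"
      proof (rule mult_right_mono)
        have "\<gamma> * t \<le> \<gamma> * T" using t \<gamma> by simp
        then have "exp (- (c + \<gamma> * T)) \<le> exp (- c) * exp (- (\<gamma> * t))"
          by (simp add: exp_add[symmetric])
        then show "exp (- (c + \<gamma> * T)) \<le> weight \<gamma> c k i x t"
          using weight_bounds(1)[OF x, where c = c and k = k and \<gamma> = \<gamma> and t = t and i = i] c by linarith
      qed auto
      also have "\<dots> \<le> 2 * D" using x t by (intro fin) (force simp: S_def Q_def)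
      finally show ?thesis by (simp only: exp_minus) (simp add: divide_simps mult_ac)
    qed
    then have "(\<Sum>i\<in>UNIV. \<bar>w x t $ i\<bar>) \<le> n * (2 * exp (c + \<gamma> * T) * D)"
      unfolding n_def by (intro sum_bounded_above) auto
    then show ?thesis
      using norm_le_l1_cart[of "w x t"] by (simp add: w_def C_def mult.assoc)
  qed
  with C show thesis using that by blast
qed

theorem theorem2p3:
  fixes k :: nat
    and lam :: "'n::{finite,linorder} \<Rightarrow> real \<Rightarrow> real \<Rightarrow> real"
    and f :: "real \<Rightarrow> real \<Rightarrow> real ^ 'n::{finite,linorder} \<Rightarrow> real ^ 'n::{finite,linorder}"
    and h :: "real \<Rightarrow> real ^ 'n::{finite,linorder} \<Rightarrow> real ^ 'n::{finite,linorder}"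
  assumes k: "1 \<le> k" "k \<le> CARD('n)"
    and lam_neg: "\<And>i x t. index_rank i \<le> k \<Longrightarrow> (x, t) \<in> closure Pi_dom \<Longrightarrow> lam i x t < 0"
    and lam_pos: "\<And>i x t. k < index_rank i \<Longrightarrow> (x, t) \<in> closure Pi_dom \<Longrightarrow> lam i x t > 0"
    and lam_cont: "\<And>i. continuous_on (closure Pi_dom) (\<lambda>(x, t). lam i x t)"
    and lam_lipschitz: "\<And>i K. compact K \<Longrightarrow> K \<subseteq> {0..} \<Longrightarrow>
          \<exists>L. \<forall>t\<in>K. L-lipschitz_on {0..1} (\<lambda>x. lam i x t)"
    and f_cont: "continuous_on (closure Pi_dom \<times> UNIV) (\<lambda>((x, t), y). f x t y)"
    and f_diff: "\<And>x t y. (x, t) \<in> closure Pi_dom \<Longrightarrow> f x t differentiable (at y)"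
    and f_grad_bounded: "\<And>K. compact K \<Longrightarrow> K \<subseteq> closure Pi_dom \<Longrightarrow>
          bounded ((\<lambda>((x, t), y). jacobian (f x t) (at y)) ` (K \<times> UNIV))"
    and h_cont: "continuous_on ({0..} \<times> UNIV) (\<lambda>(t, z). h t z)"
    and h_diff: "\<And>t z. 0 \<le> t \<Longrightarrow> h t differentiable (at z)"
    and h_grad_bounded: "\<And>K. compact K \<Longrightarrow> K \<subseteq> {0..} \<Longrightarrow>
          bounded ((\<lambda>(t, z). jacobian (h t) (at z)) ` (K \<times> UNIV))"
    and f_zero: "\<And>x t. (x, t) \<in> closure Pi_dom \<Longrightarrow> f x t 0 = 0"
    and h_zero: "\<And>t. 0 \<le> t \<Longrightarrow> h t 0 = 0"
  shows "\<forall>T>0. \<forall>\<phi>\<^sub>0\<in>admissible_data k h. \<forall>u\<^sub>0. continuous_solution k lam f \<phi>\<^sub>0 h u\<^sub>0 \<longrightarrow>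
           (\<forall>\<epsilon>>0. \<exists>\<delta>>0. \<forall>\<phi>\<in>admissible_data k h. \<forall>u. continuous_solution k lam f \<phi> h u \<longrightarrow>
              sup_norm_on {0..1} (\<lambda>x. \<phi> x - \<phi>\<^sub>0 x) < \<delta> \<longrightarrow>
              sup_norm_on ({0..1} \<times> {0..T}) (\<lambda>(x, t). u x t - u\<^sub>0 x t) < \<epsilon>)"
proof (intro allI impI ballI)
  fix T :: real and \<phi>\<^sub>0 u\<^sub>0 and \<epsilon> :: real
  assume "0 < T" and \<phi>\<^sub>0: "\<phi>\<^sub>0 \<in> admissible_data k h"
    and u\<^sub>0: "continuous_solution k lam f \<phi>\<^sub>0 h u\<^sub>0" and "0 < \<epsilon>"
  obtain C where C: "C \<ge> 0"
    "\<And>\<phi> \<psi> u v D x t. continuous_solution k lam f \<phi> h u \<Longrightarrow> continuous_solution k lam f \<psi> h v \<Longrightarrow>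
      (\<And>y. y \<in> {0..1} \<Longrightarrow> norm (\<phi> y - \<psi> y) \<le> D) \<Longrightarrow> x \<in> {0..1} \<Longrightarrow> t \<in> {0..T} \<Longrightarrow>
      norm (u x t - v x t) \<le> C * D"
    by (rule solution_difference_bound[OF lam_neg lam_pos lam_cont lam_lipschitz f_cont f_diff f_grad_bounded
          h_diff h_grad_bounded, where T = T]) (assumption | rule that | blast)+
  \<comment> \<open>The added 1 covers \<open>C = 0\<close> and makes
    \<open>C * \<delta> < \<epsilon>\<close> strict.\<close>
  define \<delta> where "\<delta> = \<epsilon> / (C + 1)"
  have "\<delta> > 0" using C(1) \<open>0 < \<epsilon>\<close> by (simp add: \<delta>_def)
  moreover have "sup_norm_on ({0..1} \<times> {0..T}) (\<lambda>(x, t). u x t - u\<^sub>0 x t) < \<epsilon>"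
    if \<phi>: "\<phi> \<in> admissible_data k h" and u: "continuous_solution k lam f \<phi> h u"
      and small: "sup_norm_on {0..1} (\<lambda>x. \<phi> x - \<phi>\<^sub>0 x) < \<delta>" for \<phi> u
  proof -
    have "continuous_on {0..1} (\<lambda>x. norm (\<phi> x - \<phi>\<^sub>0 x))"
      using \<phi> \<phi>\<^sub>0 by (auto simp: admissible_data_def intro!: continuous_intros)
    \<comment> \<open>\<open>sup_norm_on\<close> is a supremum of reals and is known to dominate the
      values only when these are bounded above.\<close>
    then have bdd: "bdd_above ((\<lambda>x. norm (\<phi> x - \<phi>\<^sub>0 x)) ` {0..1})"
      by (intro bounded_imp_bdd_above compact_imp_bounded compact_continuous_image) auto
    have D: "norm (\<phi> y - \<phi>\<^sub>0 y) \<le> \<delta>" if "y \<in> {0..1}" for y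
      using cSUP_upper[OF that bdd] small by (simp add: sup_norm_on_def)
    have "sup_norm_on ({0..1} \<times> {0..T}) (\<lambda>(x, t). u x t - u\<^sub>0 x t) \<le> C * \<delta>"
      unfolding sup_norm_on_def using \<open>0 < T\<close> C(2)[OF u u\<^sub>0 D] by (intro cSUP_least) auto
    also have "\<dots> < \<epsilon>"
      using C(1) \<open>0 < \<epsilon>\<close> by (simp add: \<delta>_def field_simps)
    finally show ?thesis .
  qed
  ultimately show "\<exists>\<delta>>0. \<forall>\<phi>\<in>admissible_data k h. \<forall>u. continuous_solution k lam f \<phi> h u \<longrightarrow>
      sup_norm_on {0..1} (\<lambda>x. \<phi> x - \<phi>\<^sub>0 x) < \<delta> \<longrightarrow>
      sup_norm_on ({0..1} \<times> {0..T}) (\<lambda>(x, t). u x t - u\<^sub>0 x t) < \<epsilon>"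
    by blast
qed

end
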